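(* Let $(X,\gamma)$ be a generalized Minkowski space. The following are equivalent. (a) $\gamma$ is a norm. (b) For any two distinct points $x,y\in X$, $|\mathrm{ft}(\{x,y\})|>1$. (c) For any two distinct points $x,y\in X$, $|\mathrm{ft}(\{x,y\})|=\infty$. (d) For any two distinct points $x,y\in X$, $\mathrm{ft}(\{x,y\})\setminus\{x\}\ne\emptyset$. (e) For any two distinct points $x,y\in X$, $\mathrm{ft}(\{x,y\})\setminus\{x,y\}\ne\emptyset$. (f) For any two distinct points $x,y\in X$, $x\in\mathrm{ft}(\{x,y\})$. (g) For any two distinct points $x,y\in X$, $\{x,y\}\subseteq\mathrm{ft}(\{x,y\})$. (h) For any two distinct points $x,y\in X$, $[x,y]\subseteq\mathrm{ft}(\{x,y\})$. (i) For any two distinct points $x,y\in X$, $\mathrm{relint}([x,y])\cap\mathrm{ft}(\{x,y\})\neq\emptyset$. (j) For any two distinct points $x,y\in X$, $[x,y]_\gamma\subseteq\mathrm{ft}(\{x,y\})$. (k) For any two distinct points $x,y\in X$, $\mathrm{relint}([x,y]_\gamma)\cap\mathrm{ft}(\{x,y\})\ne\emptyset$. (l) For any two distinct points $x,y\in X$, $[x,y]_\gamma=\mathrm{ft}(\{x,y\})$.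
   Context: $X$ is a finite-dimensional real vector space. A gauge on $X$ is a function $\gamma:X\to[0,+\infty)$ such that $\gamma(x)=0$ implies $x=0$; $\gamma(\lambda x)=\lambda\gamma(x)$ for all $x\in X$, $\lambda\ge 0$; and $\gamma(x+y)\le\gamma(x)+\gamma(y)$ for all $x,y\in X$ (no symmetry is assumed). The pair $(X,\gamma)$ is called a generalized Minkowski space; $\gamma$ is a norm iff additionally $\gamma(-x)=\gamma(x)$ for all $x\in X$. $[x,y]$ is the closed line segment between $x$ and $y$. $[x,y]_\gamma=\{z\in X:\gamma(x-z)+\gamma(z-y)=\gamma(x-y)\}$. $\mathrm{relint}(A)$ is the relative interior of $A$, i.e. the interior of $A$ in the natural topology of its affine hull. For distinct $x,y\in X$, $\mathrm{ft}(\{x,y\})$ is the set of all minimizers over $z\in X$ of $z\mapsto\gamma(x-z)+\gamma(y-z)$. *)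

theory Defs
  imports "HOL-Analysis.Analysis"
begin

text \<open>Gauges need not be symmetric; the name avoids the Henstock-Kurzweil constant \<open>gauge\<close>.\<close>

definition is_gauge :: "('a::real_vector \<Rightarrow> real) \<Rightarrow> bool" where
  "is_gauge \<gamma> \<longleftrightarrow>
     (\<forall>x. 0 \<le> \<gamma> x) \<and>
     (\<forall>x. \<gamma> x = 0 \<longrightarrow> x = 0) \<and>
     (\<forall>x. \<forall>c\<ge>0. \<gamma> (c *\<^sub>R x) = c * \<gamma> x) \<and>
     (\<forall>x y. \<gamma> (x + y) \<le> \<gamma> x + \<gamma> y)"

definition is_norm :: "('a::real_vector \<Rightarrow> real) \<Rightarrow> bool" where
  "is_norm \<gamma> \<longleftrightarrow> is_gauge \<gamma> \<and> (\<forall>x. \<gamma> (- x) = \<gamma> x)"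

definition gauge_segment :: "('a::real_vector \<Rightarrow> real) \<Rightarrow> 'a \<Rightarrow> 'a \<Rightarrow> 'a set" where
  "gauge_segment \<gamma> x y = {z. \<gamma> (x - z) + \<gamma> (z - y) = \<gamma> (x - y)}"

text \<open>The Fermat--Torricelli locus of \<open>{x, y}\<close>, for \<open>x \<noteq> y\<close>. In both terms the moving
  point is the one subtracted, unlike in \<open>gauge_segment\<close>.\<close>

definition ft :: "('a::real_vector \<Rightarrow> real) \<Rightarrow> 'a \<Rightarrow> 'a \<Rightarrow> 'a set" where
  "ft \<gamma> x y = {z. \<forall>w. \<gamma> (x - z) + \<gamma> (y - z) \<le> \<gamma> (x - w) + \<gamma> (y - w)}"

text \<open>A type of class \<open>real_vector\<close> carries no topology, which \<open>rel_interior\<close> would need.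
  In finite dimension the natural topology is the coarsest one that makes every linear
  functional (equivalently, the coordinates with respect to a basis) continuous; only
  finite-dimensional instances are intended. On a Euclidean space one gets back the
  library's topology and relative interior, as shown below.\<close>

definition natural_topology :: "'a::real_vector topology" where
  "natural_topology =
     topology_generated_by {f -` U | (f :: 'a \<Rightarrow> real) U. linear f \<and> open U}"

definition relint :: "'a::real_vector set \<Rightarrow> 'a set" where
  "relint A = (subtopology natural_topology (affine hull A)) interior_of A"

lemma natural_topology_euclidean:
  "natural_topology = (euclidean :: 'a::euclidean_space topology)"
proof -
  let ?G = "{f -` U | (f :: 'a \<Rightarrow> real) U. linear f \<and> open U}"
  have "openin euclidean S" if "openin natural_topology S" for S :: "'a set"
  proof -
    have "generate_topology_on ?G S"
      using that by (simp add: natural_topology_def openin_topology_generated_by_iff)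
    then have "open S"
    proof induction
      case (Basis s)
      then obtain f :: "'a \<Rightarrow> real" and U where s: "s = f -` U" "linear f" "open U"
        by blast
      have "continuous_on UNIV f"
        using \<open>linear f\<close> by (simp add: linear_continuous_on linear_conv_bounded_linear)
      then show ?case
        using s by (simp add: open_vimage)
    qed auto
    then show ?thesis by simp
  qed
  moreover have "openin natural_topology S" if "openin euclidean S" for S :: "'a set"
  proof -
    have "\<exists>T. openin natural_topology T \<and> x \<in> T \<and> T \<subseteq> S" if x: "x \<in> S" for x
    proof -
      have "open S" using \<open>openin euclidean S\<close> by simp
      then obtain a b where ab: "box a b \<subseteq> S" "x \<in> box a b"
        using x by (rule open_contains_box)
      have *: "box a b = (\<Inter>i\<in>Basis. (\<lambda>y. y \<bullet> i) -` {a \<bullet> i<..<b \<bullet> i})"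
        by (auto simp: box_def)
      have "openin natural_topology ((\<lambda>y. y \<bullet> i) -` {a \<bullet> i<..<b \<bullet> i})" for i :: 'a
      proof -
        have "linear (\<lambda>y. y \<bullet> i)"
          by (rule bounded_linear.linear[OF bounded_linear_inner_left])
        then have "(\<lambda>y. y \<bullet> i) -` {a \<bullet> i<..<b \<bullet> i} \<in> ?G"
          using open_greaterThanLessThan by blast
        then show ?thesis
          unfolding natural_topology_def by (rule topology_generated_by_Basis)
      qed
      then have "openin natural_topology (box a b)"
        unfolding * by (intro openin_INT2) auto
      with ab show ?thesis by blast
    qed
    then show ?thesis
      using openin_subopen[of natural_topology S] by blast
  qed
  ultimately show ?thesis
    unfolding topology_eq by blast
qed

lemma relint_euclidean: "relint A = rel_interior A" for A :: "'a::euclidean_space set"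
  by (simp add: relint_def rel_interior_def natural_topology_euclidean interior_of_def)

end

theory Submission
  imports Defs
begin

text \<open>For a norm, \<open>\<gamma> (y - z) = \<gamma> (z - y)\<close> turns the function minimized by the locus into
  \<open>\<gamma> (x - z) + \<gamma> (z - y)\<close>. By the triangle inequality its minimum is \<open>\<gamma> (x - y)\<close>, so
  the locus is the whole gauge segment (\<open>norm_gauge_segment_eq_ft\<close>). This set contains the line
  segment and is convex, and every other property follows; for those on relative interiors one
  needs that a nonempty convex set in finite dimension has a relatively interior point
  (\<open>relint_convex_nonempty\<close>).

  Conversely, each property forces one of two things for all distinct \<open>x\<close> and \<open>y\<close>. Either \<open>x\<close>
  is a minimizer; then comparing with the value at \<open>y\<close> gives \<open>\<gamma> (y - x) \<le> \<gamma> (x - y)\<close>, and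
  exchanging the points gives symmetry (\<open>is_norm_if_endpoint_in_ft\<close>). Or some minimizer differs
  from \<open>x\<close>. For the properties on relative interiors this holds because the gauge
  segment does not continue beyond \<open>x\<close>, so \<open>x\<close> is not in its relative interior (\<open>endpoint_notin_relint\<close>). A gauge that
  is not symmetric violates this second alternative (\<open>exists_ft_singleton\<close>): if \<open>a\<close> maximizes
  the asymmetry \<open>\<gamma> (- u) / \<gamma> u\<close>, then \<open>0\<close> is the only minimizer for the pair \<open>0\<close>, \<open>a\<close>.
  Finite dimension provides the maximizer, by compactness (\<open>exists_maximal_asymmetry\<close>).\<close>

section \<open>Gauges\<close>

lemma gauge_nonneg: "is_gauge \<gamma> \<Longrightarrow> 0 \<le> \<gamma> x"
  by (simp add: is_gauge_def)

lemma gauge_scaleR: "is_gauge \<gamma> \<Longrightarrow> 0 \<le> c \<Longrightarrow> \<gamma> (c *\<^sub>R x) = c * \<gamma> x"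
  by (simp add: is_gauge_def)

lemma gauge_triangle: "is_gauge \<gamma> \<Longrightarrow> \<gamma> (x + y) \<le> \<gamma> x + \<gamma> y"
  by (simp add: is_gauge_def)

lemma gauge_zero: "is_gauge \<gamma> \<Longrightarrow> \<gamma> 0 = 0"
  using gauge_scaleR[of \<gamma> 0 0] by simp

lemma gauge_pos: "is_gauge \<gamma> \<Longrightarrow> x \<noteq> 0 \<Longrightarrow> 0 < \<gamma> x"
  by (metis gauge_nonneg is_gauge_def order_le_less)

lemma gauge_diff_triangle: "is_gauge \<gamma> \<Longrightarrow> \<gamma> (x - y) \<le> \<gamma> (x - z) + \<gamma> (z - y)"
  using gauge_triangle[of \<gamma> "x - z" "z - y"] by simp

lemma gauge_sum_le:
  assumes "is_gauge \<gamma>"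
  shows "\<gamma> (\<Sum>i\<in>I. f i) \<le> (\<Sum>i\<in>I. \<gamma> (f i))"
proof (induction I rule: infinite_finite_induct)
  case (insert i I)
  then show ?case
    using gauge_triangle[OF assms, of "f i" "sum f I"] by simp
qed (simp_all add: gauge_zero[OF assms])

lemma gauge_scaleR_le:
  assumes "is_gauge \<gamma>"
  shows "\<gamma> (c *\<^sub>R x) \<le> \<bar>c\<bar> * (\<gamma> x + \<gamma> (- x))"
proof (cases "0 \<le> c")
  case True
  then show ?thesis
    using gauge_scaleR[OF assms True, of x] gauge_nonneg[OF assms, of "- x"]
    by (simp add: distrib_left)
next
  case False
  then show ?thesis
    using gauge_scaleR[OF assms, of "- c" "- x"] gauge_nonneg[OF assms, of x]
    by (simp add: mult_left_mono)
qed

text \<open>No symmetry means that the difference of two values is only controlled by the gauge in one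
  direction; bounding each coordinate by the sum of both directions repairs this.\<close>

lemma continuous_on_gauge_combination:
  fixes \<gamma> :: "'a::real_vector \<Rightarrow> real"
  assumes "is_gauge \<gamma>"
  shows "continuous_on UNIV (\<lambda>c :: 'a \<Rightarrow> real. \<gamma> (\<Sum>b\<in>B. c b *\<^sub>R b))"
proof -
  define L where "L c = (\<Sum>b\<in>B. c b *\<^sub>R b)" for c :: "'a \<Rightarrow> real"
  define M where "M d c = (\<Sum>b\<in>B. \<bar>c b - d b\<bar> * (\<gamma> b + \<gamma> (- b)))" for c d :: "'a \<Rightarrow> real"
  have le: "\<gamma> (L c) - \<gamma> (L d) \<le> M d c" for c d
  proof -
    have "\<gamma> (L c) - \<gamma> (L d) \<le> \<gamma> (L c - L d)"
      using gauge_triangle[OF assms, of "L c - L d" "L d"] by simp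
    also have "L c - L d = (\<Sum>b\<in>B. (c b - d b) *\<^sub>R b)"
      by (simp add: L_def sum_subtractf scaleR_left_diff_distrib)
    also have "\<gamma> \<dots> \<le> (\<Sum>b\<in>B. \<gamma> ((c b - d b) *\<^sub>R b))"
      by (rule gauge_sum_le[OF assms])
    also have "\<dots> \<le> M d c"
      unfolding M_def by (intro sum_mono gauge_scaleR_le[OF assms])
    finally show ?thesis .
  qed
  have M_sym: "M c d = M d c" for c d
    by (simp add: M_def abs_minus_commute)
  have *: "((\<lambda>c. \<gamma> (L c)) \<longlongrightarrow> \<gamma> (L d)) (at d)" for d
  proof -
    have "continuous_on UNIV (M d)"
      unfolding M_def by (intro continuous_intros) auto
    then have "(M d \<longlongrightarrow> M d d) (at d)"
      by (simp add: continuous_on_def)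
    then have "(M d \<longlongrightarrow> 0) (at d)"
      by (simp add: M_def)
    moreover have "norm (\<gamma> (L c) - \<gamma> (L d)) \<le> M d c" for c
      using le[of c d] le[of d c] M_sym[of c d] by (simp add: abs_le_iff)
    then have "\<forall>\<^sub>F c in at d. norm (\<gamma> (L c) - \<gamma> (L d)) \<le> M d c"
      by (intro always_eventually allI)
    ultimately have "((\<lambda>c. \<gamma> (L c) - \<gamma> (L d)) \<longlongrightarrow> 0) (at d)"
      by (rule Lim_null_comparison[rotated])
    then show ?thesis
      by (rule LIM_zero_cancel)
  qed
  show ?thesis
    using * by (simp add: continuous_on_def L_def)
qed

text \<open>The quotient \<open>\<gamma> (- u) / \<gamma> u\<close> is continuous and invariant under positive scaling, so it
  attains its supremum on a compact sphere of coordinate vectors. The sphere lives in the product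
  topology on functions, where closed and bounded sets of finitely supported vectors with a fixed
  support are compact.\<close>

lemma exists_maximal_asymmetry:
  fixes \<gamma> :: "'a::real_vector \<Rightarrow> real"
  assumes "finite C" and "span C = (UNIV :: 'a set)" and gauge: "is_gauge \<gamma>" and "(v :: 'a) \<noteq> 0"
  obtains a where "a \<noteq> 0" and "\<And>u. \<gamma> (- u) * \<gamma> a \<le> \<gamma> (- a) * \<gamma> u"
proof -
  obtain B where B: "B \<subseteq> C" "independent B" "C \<subseteq> span B"
    by (rule maximal_independent_subset)
  have "finite B"
    using B(1) \<open>finite C\<close> by (rule finite_subset)
  have "span B = UNIV"
    using span_mono[OF B(3)] \<open>span C = UNIV\<close> by (simp add: span_span top.extremum_unique)
  define L where "L c = (\<Sum>b\<in>B. c b *\<^sub>R b)" for c :: "'a \<Rightarrow> real"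
  define K where "K = PiE UNIV (\<lambda>b. if b \<in> B then {-1..1} else {0 :: real})
    \<inter> {c. (\<Sum>b\<in>B. \<bar>c b\<bar>) = 1}"
  have "compactin (product_topology (\<lambda>_. euclidean) UNIV)
      (PiE UNIV (\<lambda>b. if b \<in> B then {-1..1} else {0 :: real}))"
    unfolding compactin_PiE by auto
  then have "compact (PiE UNIV (\<lambda>b. if b \<in> B then {-1..1} else {0 :: real}))"
    by (simp add: euclidean_product_topology)
  moreover have "closed {c :: 'a \<Rightarrow> real. (\<Sum>b\<in>B. \<bar>c b\<bar>) = 1}"
    by (intro closed_Collect_eq continuous_intros) auto
  ultimately have "compact K"
    unfolding K_def by (rule compact_Int_closed)
  have on_sphere: "\<exists>c\<in>K. \<exists>s>0. u = s *\<^sub>R L c" if "u \<noteq> 0" for u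
  proof -
    obtain d where d: "u = L d"
      using \<open>span B = UNIV\<close> span_finite[OF \<open>finite B\<close>] unfolding L_def by blast
    define s where "s = (\<Sum>b\<in>B. \<bar>d b\<bar>)"
    have "s \<noteq> 0"
    proof
      assume "s = 0"
      then have "\<forall>b\<in>B. d b = 0"
        unfolding s_def using sum_nonneg_eq_0_iff[OF \<open>finite B\<close>, of "\<lambda>b. \<bar>d b\<bar>"] by simp
      then show False
        using d \<open>u \<noteq> 0\<close> by (simp add: L_def)
    qed
    moreover have "0 \<le> s"
      unfolding s_def by (intro sum_nonneg) simp
    ultimately have "0 < s"
      by simp
    \<comment> \<open>Coordinates outside the basis must vanish for \<open>c\<close> to lie in the compact product.\<close>
    define c where "c b = (if b \<in> B then d b / s else 0)" for b
    have "(\<Sum>b\<in>B. \<bar>c b\<bar>) = 1"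
      using \<open>0 < s\<close> by (simp add: c_def s_def flip: sum_divide_distrib)
    moreover have "\<bar>d b\<bar> \<le> s" if "b \<in> B" for b
      unfolding s_def using member_le_sum[OF that _ \<open>finite B\<close>, of "\<lambda>b. \<bar>d b\<bar>"] by simp
    then have "c b \<in> {-1..1}" if "b \<in> B" for b
      using that \<open>0 < s\<close> by (force simp: c_def field_simps abs_le_iff)
    ultimately have "c \<in> K"
      by (auto simp: K_def c_def)
    moreover have "u = s *\<^sub>R L c"
      using \<open>0 < s\<close> by (simp add: d L_def c_def scaleR_sum_right)
    ultimately show ?thesis
      using \<open>0 < s\<close> by blast
  qed
  have nonzero: "L c \<noteq> 0" if "c \<in> K" for c
  proof
    assume "L c = 0"
    then have "\<forall>b\<in>B. c b = 0"
      using independentD[OF B(2) \<open>finite B\<close> subset_refl] by (auto simp: L_def)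
    then show False
      using that by (simp add: K_def)
  qed
  have "K \<noteq> {}"
    using on_sphere[OF \<open>v \<noteq> 0\<close>] by blast
  have cont: "continuous_on K (\<lambda>c. \<gamma> (L c))"
    using continuous_on_gauge_combination[OF gauge, of B] unfolding L_def
    by (rule continuous_on_subset) simp
  have "continuous_on K (\<lambda>c. \<gamma> (L (\<lambda>b. - c b)))"
    using continuous_on_gauge_combination[OF gauge, of B] unfolding L_def
    by (rule continuous_on_compose2) (auto intro!: continuous_intros continuous_on_subset[OF continuous_on_product_coordinates])
  then have "continuous_on K (\<lambda>c. \<gamma> (- L c))"
    by (simp add: L_def sum_negf)
  then have "continuous_on K (\<lambda>c. \<gamma> (- L c) / \<gamma> (L c))"
    using cont by (rule continuous_on_divide) (use nonzero gauge_pos[OF gauge] in force)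
  then obtain m where m: "m \<in> K" "\<And>c. c \<in> K \<Longrightarrow> \<gamma> (- L c) / \<gamma> (L c) \<le> \<gamma> (- L m) / \<gamma> (L m)"
    using continuous_attains_sup[OF \<open>compact K\<close> \<open>K \<noteq> {}\<close>] by blast
  have "\<gamma> (- u) * \<gamma> (L m) \<le> \<gamma> (- L m) * \<gamma> u" for u
  proof (cases "u = 0")
    case True
    then show ?thesis by (simp add: gauge_zero[OF gauge])
  next
    case False
    then obtain c s where c: "c \<in> K" "0 < s" "u = s *\<^sub>R L c"
      using on_sphere by blast
    have "\<gamma> (- L c) * \<gamma> (L m) \<le> \<gamma> (- L m) * \<gamma> (L c)"
      using m(2)[OF c(1)] gauge_pos[OF gauge nonzero[OF c(1)]] gauge_pos[OF gauge nonzero[OF m(1)]]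
      by (simp add: divide_simps)
    then have "s * (\<gamma> (- L c) * \<gamma> (L m)) \<le> s * (\<gamma> (- L m) * \<gamma> (L c))"
      using c(2) by simp
    then show ?thesis
      using c(2,3) gauge_scaleR[OF gauge, of s "L c"] gauge_scaleR[OF gauge, of s "- L c"]
      by (simp add: mult_ac)
  qed
  with nonzero[OF m(1)] show thesis
    by (rule that)
qed

section \<open>A one-point locus for every asymmetric gauge\<close>

text \<open>Let \<open>R > 1\<close> be the maximal value of \<open>\<gamma> (- u) / \<gamma> u\<close>, attained at \<open>a\<close>. Then
  \<open>\<gamma> (a - u) \<ge> \<gamma> (u - a) / R \<ge> (\<gamma> (- a) - \<gamma> (- u)) / R = \<gamma> a - \<gamma> (- u) / R\<close>, so moving
  from \<open>0\<close> to \<open>u\<close> costs \<open>\<gamma> (- u)\<close> and saves at most \<open>\<gamma> (- u) / R\<close>, which is strictly less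
  unless \<open>u = 0\<close>.\<close>

lemma exists_ft_singleton:
  fixes \<gamma> :: "'a::real_vector \<Rightarrow> real"
  assumes "finite C" and "span C = (UNIV :: 'a set)" and gauge: "is_gauge \<gamma>" and "\<not> is_norm \<gamma>"
  obtains a where "a \<noteq> 0" and "ft \<gamma> 0 a \<subseteq> {0}"
proof -
  obtain v where v: "\<gamma> v < \<gamma> (- v)"
    using \<open>\<not> is_norm \<gamma>\<close> gauge unfolding is_norm_def by (metis linorder_neqE minus_minus)
  then have "v \<noteq> 0"
    by auto
  then obtain a where a: "a \<noteq> 0" "\<And>u. \<gamma> (- u) * \<gamma> a \<le> \<gamma> (- a) * \<gamma> u"
    using exists_maximal_asymmetry[OF assms(1-3)] by blast
  have a_pos: "0 < \<gamma> a" and v_pos: "0 < \<gamma> v"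
    using a(1) \<open>v \<noteq> 0\<close> gauge_pos[OF gauge] by auto
  have "\<gamma> v * \<gamma> a < \<gamma> (- v) * \<gamma> a"
    using v a_pos by simp
  also have "\<dots> \<le> \<gamma> (- a) * \<gamma> v"
    by (rule a(2))
  finally have asym: "\<gamma> a < \<gamma> (- a)"
    using v_pos by (simp add: mult.commute)
  have "u = 0" if "u \<in> ft \<gamma> 0 a" for u
  proof (rule ccontr)
    assume "u \<noteq> 0"
    then have u_pos: "0 < \<gamma> (- u)"
      using gauge_pos[OF gauge] by simp
    have "\<gamma> (- u) + \<gamma> (a - u) \<le> \<gamma> a"
      using that gauge_zero[OF gauge] unfolding ft_def
      by (auto dest: spec[where x = 0])
    then have "\<gamma> (- a) * (\<gamma> (- u) + \<gamma> (a - u)) \<le> \<gamma> (- a) * \<gamma> a"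
      by (rule mult_left_mono) (rule gauge_nonneg[OF gauge])
    moreover have "(\<gamma> (- a) - \<gamma> (- u)) * \<gamma> a \<le> \<gamma> (- a) * \<gamma> (a - u)"
    proof -
      have "\<gamma> (- a) - \<gamma> (- u) \<le> \<gamma> (- (a - u))"
        using gauge_triangle[OF gauge, of "- (a - u)" "- u"] by simp
      then have "(\<gamma> (- a) - \<gamma> (- u)) * \<gamma> a \<le> \<gamma> (- (a - u)) * \<gamma> a"
        using a_pos by simp
      also have "\<dots> \<le> \<gamma> (- a) * \<gamma> (a - u)"
        by (rule a(2))
      finally show ?thesis .
    qed
    ultimately have "\<gamma> (- a) * \<gamma> (- u) \<le> \<gamma> a * \<gamma> (- u)"
      by (simp add: algebra_simps)
    then show False
      using asym u_pos by simp
  qed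
  then show thesis
    using a(1) that by blast
qed

section \<open>Relative interiors in the natural topology\<close>

text \<open>Linear functionals are affine in the parameter of a line, so lines are continuous curves.\<close>

lemma openin_natural_topology_line:
  fixes x v :: "'a::real_vector"
  assumes "openin natural_topology U"
  shows "open {t :: real. x + t *\<^sub>R v \<in> U}"
proof -
  have "continuous_map euclidean natural_topology (\<lambda>t :: real. x + t *\<^sub>R v)"
    unfolding natural_topology_def
  proof (rule continuous_on_generated_topo)
    fix V assume "V \<in> {f -` U | (f :: 'a \<Rightarrow> real) U. linear f \<and> open U}"
    then obtain f :: "'a \<Rightarrow> real" and W where V: "V = f -` W" "linear f" "open W"
      by blast
    have "(\<lambda>t. x + t *\<^sub>R v) -` V = (\<lambda>t. f x + t * f v) -` W"
      by (auto simp: V(1) linear_add[OF V(2)] linear_scale[OF V(2)])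
    moreover have "open ((\<lambda>t. f x + t * f v) -` W)"
      using V(3) by (rule open_vimage) (intro continuous_intros)
    ultimately show "openin euclidean ((\<lambda>t. x + t *\<^sub>R v) -` V \<inter> topspace euclidean)"
      by simp
  next
    have "UNIV = (\<lambda>_. 0) -` (UNIV :: real set) \<and> linear (\<lambda>_ :: 'a. 0 :: real) \<and> open (UNIV :: real set)"
      by (simp add: linear_0 module_hom_zero)
    then have "UNIV \<in> {f -` U | (f :: 'a \<Rightarrow> real) U. linear f \<and> open U}"
      by (intro CollectI exI[of _ "\<lambda>_. 0"] exI[of _ "UNIV :: real set"])
    then show "(\<lambda>t. x + t *\<^sub>R v) ` topspace euclidean
        \<subseteq> \<Union> {f -` U | (f :: 'a \<Rightarrow> real) U. linear f \<and> open U}"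
      by (rule order_trans[OF subset_UNIV Union_upper])
  qed
  from openin_continuous_map_preimage[OF this assms] show ?thesis
    by simp
qed

lemma relint_subset: "relint A \<subseteq> A"
  unfolding relint_def by (rule interior_of_subset)

text \<open>A relatively interior point is no endpoint: the set contains a little more of each line
  that joins it to another point of the set.\<close>

lemma relint_extend_beyond:
  fixes x y :: "'a::real_vector"
  assumes "x \<in> relint A" and "y \<in> A"
  obtains e :: real where "0 < e" and "x + e *\<^sub>R (x - y) \<in> A"
proof -
  obtain T where T: "openin (subtopology natural_topology (affine hull A)) T" "x \<in> T" "T \<subseteq> A"
    using assms(1) unfolding relint_def interior_of_def by blast
  then obtain U where U: "openin natural_topology U" "T = U \<inter> affine hull A"
    unfolding openin_subtopology by blast
  have "open {t. x + t *\<^sub>R (x - y) \<in> U}" (is "open ?O")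
    using U(1) by (rule openin_natural_topology_line)
  moreover have "0 \<in> ?O"
    using T(2) U(2) by simp
  ultimately obtain d where d: "0 < d" "\<And>t. dist t 0 < d \<Longrightarrow> t \<in> ?O"
    unfolding open_dist by blast
  have "d / 2 \<in> ?O"
    using d(1) by (intro d(2)) simp
  moreover have "x \<in> affine hull A" "y \<in> affine hull A"
    using relint_subset assms by (auto intro: hull_inc)
  then have "(1 + d / 2) *\<^sub>R x + (- (d / 2)) *\<^sub>R y \<in> affine hull A"
    by (intro mem_affine[OF affine_affine_hull]) auto
  then have "x + (d / 2) *\<^sub>R (x - y) \<in> affine hull A"
    by (simp add: algebra_simps)
  ultimately show thesis
    using d(1) T(3) U(2) by (intro that[of "d / 2"]) auto
qed

text \<open>Choose \<open>a\<close> in the set and a maximal linearly independent set \<open>S\<close> of differences with \<open>a\<close>.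
  Within the affine hull, the interior of the simplex with vertices \<open>a\<close> and \<open>a + s\<close> for \<open>s \<in> S\<close> is cut out by
  strict inequalities between linear functionals; the barycentre lies in it.\<close>

lemma relint_convex_nonempty:
  fixes A :: "'a::real_vector set"
  assumes "finite C" and "span C = (UNIV :: 'a set)" and "convex A" and "A \<noteq> {}"
  shows "relint A \<noteq> {}"
proof -
  obtain a where "a \<in> A"
    using \<open>A \<noteq> {}\<close> by blast
  obtain S where S: "S \<subseteq> (\<lambda>x. - a + x) ` A" "independent S" "(\<lambda>x. - a + x) ` A \<subseteq> span S"
    by (rule maximal_independent_subset)
  have "finite S"
    using independent_span_bound[OF \<open>finite C\<close> S(2)] \<open>span C = UNIV\<close> by simp
  have "0 \<notin> S"
    using S(2) dependent_zero by blast
  have S_in: "a + s \<in> A" if "s \<in> S" for s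
    using S(1) that by auto
  have "\<exists>f :: 'a \<Rightarrow> real. linear f \<and> (\<forall>r\<in>S. f r = (if r = s then 1 else 0))" for s
    by (rule linear_independent_extend[OF S(2)])
  then obtain \<phi> :: "'a \<Rightarrow> 'a \<Rightarrow> real"
    where \<phi>: "\<And>s. linear (\<phi> s)" "\<And>s r. r \<in> S \<Longrightarrow> \<phi> s r = (if r = s then 1 else 0)"
    by metis
  define \<sigma> where "\<sigma> x = (\<Sum>s\<in>S. \<phi> s x)" for x
  have "linear \<sigma>"
    unfolding \<sigma>_def using \<phi>(1) by (intro linear_compose_sum) auto
  have coord: "\<phi> s (\<Sum>r\<in>S. c r *\<^sub>R r) = c s" if "s \<in> S" for s c
  proof -
    have "\<phi> s (\<Sum>r\<in>S. c r *\<^sub>R r) = (\<Sum>r\<in>S. c r * \<phi> s r)"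
      by (simp add: linear_sum[OF \<phi>(1)] linear_scale[OF \<phi>(1)])
    also have "\<dots> = (\<Sum>r\<in>S. if r = s then c r else 0)"
      by (intro sum.cong) (auto simp: \<phi>(2))
    also have "\<dots> = c s"
      using that \<open>finite S\<close> by simp
    finally show ?thesis .
  qed
  define V where "V = (\<Inter>s\<in>S. \<phi> s -` {\<phi> s a<..}) \<inter> \<sigma> -` {..<\<sigma> a + 1}"
  have open_vimage_linear: "openin natural_topology (f -` W)"
    if "linear f" "open W" for f :: "'a \<Rightarrow> real" and W
    unfolding natural_topology_def using that by (intro topology_generated_by_Basis) auto
  \<comment> \<open>For a singleton \<open>A\<close> the set \<open>S\<close> is empty and the intersection below is \<open>UNIV\<close>.\<close>
  have "openin natural_topology (\<sigma> -` {..<\<sigma> a + 1} \<inter> (\<Inter>s\<in>S. \<phi> s -` {\<phi> s a<..}))"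
  proof (cases "S = {}")
    case True
    then show ?thesis
      using open_vimage_linear[OF \<open>linear \<sigma>\<close>] by simp
  next
    case False
    then show ?thesis
      using \<open>finite S\<close> \<open>linear \<sigma>\<close> \<phi>(1) by (intro openin_Int openin_INT2 open_vimage_linear) auto
  qed
  then have "openin natural_topology V"
    by (simp add: V_def Int_commute)
  then have "openin (subtopology natural_topology (affine hull A)) (V \<inter> affine hull A)"
    unfolding openin_subtopology by blast
  moreover have "V \<inter> affine hull A \<subseteq> A"
  proof
    fix z assume z: "z \<in> V \<inter> affine hull A"
    have "affine hull A = (\<lambda>x. a + x) ` span ((\<lambda>x. - a + x) ` A)"
      using \<open>a \<in> A\<close> by (intro affine_hull_span_gen hull_inc)
    also have "\<dots> \<subseteq> (\<lambda>x. a + x) ` span S"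
      using span_mono[OF S(3)] by (auto simp: span_span)
    finally obtain c where c: "z = a + (\<Sum>s\<in>S. c s *\<^sub>R s)"
      using z span_finite[OF \<open>finite S\<close>] by fastforce
    have "\<phi> s z = \<phi> s a + c s" if "s \<in> S" for s
      using coord[OF that] by (simp add: c linear_add[OF \<phi>(1)])
    then have pos: "0 < c s" if "s \<in> S" for s
      using z that by (force simp: V_def)
    have "\<sigma> z = \<sigma> a + (\<Sum>s\<in>S. c s)"
      using coord by (simp add: \<sigma>_def c linear_add[OF \<phi>(1)] sum.distrib)
    then have total: "(\<Sum>s\<in>S. c s) < 1"
      using z by (simp add: V_def)
    \<comment> \<open>The vertex \<open>a\<close>, that is the index \<open>0\<close>, takes up the remaining weight.\<close>
    define w where "w s = (if s = 0 then 1 - (\<Sum>s\<in>S. c s) else c s)" for s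
    have w_S: "w s = c s" if "s \<in> S" for s
      using that \<open>0 \<notin> S\<close> by (auto simp: w_def)
    have "(\<Sum>s\<in>insert 0 S. w s *\<^sub>R (a + s)) \<in> A"
    proof (rule convex_sum[OF _ \<open>convex A\<close>])
      show "(\<Sum>s\<in>insert 0 S. w s) = 1"
        using \<open>finite S\<close> \<open>0 \<notin> S\<close> w_S by (simp add: w_def[of 0])
      show "0 \<le> w s" if "s \<in> insert 0 S" for s
        using that pos total w_S by (cases "s = 0") (auto simp: w_def less_imp_le)
    qed (use \<open>finite S\<close> \<open>a \<in> A\<close> S_in in auto)
    also have "(\<Sum>s\<in>insert 0 S. w s *\<^sub>R (a + s))
        = (1 - (\<Sum>s\<in>S. c s)) *\<^sub>R a + (\<Sum>s\<in>S. c s *\<^sub>R (a + s))"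
      using \<open>finite S\<close> \<open>0 \<notin> S\<close> w_S by (simp add: w_def[of 0])
    also have "\<dots> = z"
      by (simp add: c scaleR_right_distrib sum.distrib scaleR_left_diff_distrib
          flip: scaleR_left.sum)
    finally show "z \<in> A" .
  qed
  moreover have "a + (\<Sum>s\<in>S. (1 / (real (card S) + 1)) *\<^sub>R s) \<in> V \<inter> affine hull A" (is "?z \<in> _")
  proof
    show "?z \<in> V"
      using coord[of _ "\<lambda>_. 1 / (real (card S) + 1)"]
      by (auto simp: V_def \<sigma>_def linear_add[OF \<phi>(1)] sum.distrib)
    have "S \<subseteq> span ((\<lambda>x. - a + x) ` A)"
      using S(1) span_superset by blast
    then have "(\<Sum>s\<in>S. (1 / (real (card S) + 1)) *\<^sub>R s) \<in> span ((\<lambda>x. - a + x) ` A)"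
      by (intro span_sum span_scale) auto
    then show "?z \<in> affine hull A"
      using affine_hull_span_gen[OF hull_inc[OF \<open>a \<in> A\<close>]] by blast
  qed
  ultimately show ?thesis
    unfolding relint_def interior_of_def by blast
qed

section \<open>Gauge segments and norms\<close>

lemma closed_segment_subset_gauge_segment:
  assumes "is_gauge \<gamma>"
  shows "closed_segment x y \<subseteq> gauge_segment \<gamma> x y"
proof
  fix z assume "z \<in> closed_segment x y"
  then obtain t where t: "0 \<le> t" "t \<le> 1" "z = (1 - t) *\<^sub>R x + t *\<^sub>R y"
    unfolding closed_segment_def by blast
  have "x - z = t *\<^sub>R (x - y)" "z - y = (1 - t) *\<^sub>R (x - y)"
    by (simp_all add: t(3) algebra_simps)
  then have "\<gamma> (x - z) = t * \<gamma> (x - y)" "\<gamma> (z - y) = (1 - t) * \<gamma> (x - y)"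
    using t(1,2) by (simp_all only: gauge_scaleR[OF assms] diff_ge_0_iff_ge)
  then show "z \<in> gauge_segment \<gamma> x y"
    by (simp add: gauge_segment_def left_diff_distrib)
qed

lemma convex_gauge_segment:
  assumes "is_gauge \<gamma>"
  shows "convex (gauge_segment \<gamma> x y)"
proof (rule convexI)
  fix p q and u v :: real
  assume pq: "p \<in> gauge_segment \<gamma> x y" "q \<in> gauge_segment \<gamma> x y"
    and uv: "0 \<le> u" "0 \<le> v" "u + v = 1"
  have "x = u *\<^sub>R x + v *\<^sub>R x" "y = u *\<^sub>R y + v *\<^sub>R y"
    using uv(3) by (simp_all flip: scaleR_left_distrib)
  then have split: "x - (u *\<^sub>R p + v *\<^sub>R q) = u *\<^sub>R (x - p) + v *\<^sub>R (x - q)"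
    "(u *\<^sub>R p + v *\<^sub>R q) - y = u *\<^sub>R (p - y) + v *\<^sub>R (q - y)"
    by (simp_all add: algebra_simps)
  have "\<gamma> (x - (u *\<^sub>R p + v *\<^sub>R q)) \<le> u * \<gamma> (x - p) + v * \<gamma> (x - q)"
    "\<gamma> ((u *\<^sub>R p + v *\<^sub>R q) - y) \<le> u * \<gamma> (p - y) + v * \<gamma> (q - y)"
    unfolding split using gauge_triangle[OF assms] uv(1,2) by (metis gauge_scaleR[OF assms])+
  moreover have "u * (\<gamma> (x - p) + \<gamma> (p - y)) + v * (\<gamma> (x - q) + \<gamma> (q - y)) = \<gamma> (x - y)"
    using pq uv(3) by (simp add: gauge_segment_def flip: distrib_right)
  ultimately show "u *\<^sub>R p + v *\<^sub>R q \<in> gauge_segment \<gamma> x y"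
    using gauge_diff_triangle[OF assms, of x y "u *\<^sub>R p + v *\<^sub>R q"]
    by (simp add: gauge_segment_def distrib_left)
qed

text \<open>Beyond \<open>x\<close>, on the ray from \<open>y\<close>, the distance to \<open>y\<close> alone already exceeds
  \<open>\<gamma> (x - y)\<close>, so the gauge segment contains no such point.\<close>

lemma endpoint_notin_relint:
  assumes gauge: "is_gauge \<gamma>" and "x \<noteq> y" and sub: "A \<subseteq> gauge_segment \<gamma> x y" and "y \<in> A"
  shows "x \<notin> relint A"
proof
  assume "x \<in> relint A"
  then obtain e where e: "0 < e" "x + e *\<^sub>R (x - y) \<in> A"
    using relint_extend_beyond \<open>y \<in> A\<close> by blast
  have "x + e *\<^sub>R (x - y) - y = (1 + e) *\<^sub>R (x - y)"
    by (simp add: algebra_simps)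
  then have "\<gamma> (- (e *\<^sub>R (x - y))) + (1 + e) * \<gamma> (x - y) = \<gamma> (x - y)"
    using e sub gauge_scaleR[OF gauge, of "1 + e" "x - y"] by (auto simp: gauge_segment_def)
  moreover have "0 < e * \<gamma> (x - y)"
    using e(1) \<open>x \<noteq> y\<close> gauge_pos[OF gauge, of "x - y"] by simp
  ultimately show False
    using gauge_nonneg[OF gauge, of "- (e *\<^sub>R (x - y))"] by (simp add: distrib_right)
qed

lemma norm_gauge_segment_eq_ft:
  assumes "is_norm \<gamma>"
  shows "gauge_segment \<gamma> x y = ft \<gamma> x y"
proof -
  have gauge: "is_gauge \<gamma>"
    using assms by (simp add: is_norm_def)
  have "\<gamma> (y - z) = \<gamma> (z - y)" for z
    using assms unfolding is_norm_def by (metis minus_diff_eq)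
  then have ft: "ft \<gamma> x y = {z. \<forall>w. \<gamma> (x - z) + \<gamma> (z - y) \<le> \<gamma> (x - w) + \<gamma> (w - y)}"
    by (simp add: ft_def)
  show ?thesis
  proof
    show "gauge_segment \<gamma> x y \<subseteq> ft \<gamma> x y"
      using gauge_diff_triangle[OF gauge] by (auto simp: ft gauge_segment_def)
    show "ft \<gamma> x y \<subseteq> gauge_segment \<gamma> x y"
    proof
      fix z assume "z \<in> ft \<gamma> x y"
      then have "\<gamma> (x - z) + \<gamma> (z - y) \<le> \<gamma> (x - x) + \<gamma> (x - y)"
        unfolding ft by blast
      then show "z \<in> gauge_segment \<gamma> x y"
        using gauge_diff_triangle[OF gauge, of x y z] gauge_zero[OF gauge]
        by (simp add: gauge_segment_def)
    qed
  qed
qed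

lemma is_norm_if_endpoint_in_ft:
  assumes gauge: "is_gauge \<gamma>" and "\<And>x y. x \<noteq> y \<Longrightarrow> x \<in> ft \<gamma> x y"
  shows "is_norm \<gamma>"
proof -
  have le: "\<gamma> v \<le> \<gamma> (- v)" for v
  proof (cases "v = 0")
    case False
    then have "\<gamma> (0 - 0) + \<gamma> (v - 0) \<le> \<gamma> (0 - v) + \<gamma> (v - v)"
      using assms(2)[of 0 v] unfolding ft_def by blast
    then show ?thesis
      by (simp add: gauge_zero[OF gauge])
  qed simp
  have "\<gamma> (- v) = \<gamma> v" for v
    using le[of v] le[of "- v"] by simp
  then show ?thesis
    using gauge by (simp add: is_norm_def)
qed

theorem corollary3p2:
  fixes \<gamma> :: "'a::real_vector \<Rightarrow> real"
  assumes finite_dim: "\<exists>B :: 'a set. finite B \<and> span B = UNIV"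
    and gauge: "is_gauge \<gamma>"
  shows
    "(is_norm \<gamma> \<longleftrightarrow> (\<forall>x y. x \<noteq> y \<longrightarrow> infinite (ft \<gamma> x y) \<or> card (ft \<gamma> x y) > 1)) \<and>
     (is_norm \<gamma> \<longleftrightarrow> (\<forall>x y. x \<noteq> y \<longrightarrow> infinite (ft \<gamma> x y))) \<and>
     (is_norm \<gamma> \<longleftrightarrow> (\<forall>x y. x \<noteq> y \<longrightarrow> ft \<gamma> x y - {x} \<noteq> {})) \<and>
     (is_norm \<gamma> \<longleftrightarrow> (\<forall>x y. x \<noteq> y \<longrightarrow> ft \<gamma> x y - {x, y} \<noteq> {})) \<and>
     (is_norm \<gamma> \<longleftrightarrow> (\<forall>x y. x \<noteq> y \<longrightarrow> x \<in> ft \<gamma> x y)) \<and>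
     (is_norm \<gamma> \<longleftrightarrow> (\<forall>x y. x \<noteq> y \<longrightarrow> {x, y} \<subseteq> ft \<gamma> x y)) \<and>
     (is_norm \<gamma> \<longleftrightarrow> (\<forall>x y. x \<noteq> y \<longrightarrow> closed_segment x y \<subseteq> ft \<gamma> x y)) \<and>
     (is_norm \<gamma> \<longleftrightarrow> (\<forall>x y. x \<noteq> y \<longrightarrow> relint (closed_segment x y) \<inter> ft \<gamma> x y \<noteq> {})) \<and>
     (is_norm \<gamma> \<longleftrightarrow> (\<forall>x y. x \<noteq> y \<longrightarrow> gauge_segment \<gamma> x y \<subseteq> ft \<gamma> x y)) \<and>
     (is_norm \<gamma> \<longleftrightarrow> (\<forall>x y. x \<noteq> y \<longrightarrow> relint (gauge_segment \<gamma> x y) \<inter> ft \<gamma> x y \<noteq> {})) \<and>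
     (is_norm \<gamma> \<longleftrightarrow> (\<forall>x y. x \<noteq> y \<longrightarrow> gauge_segment \<gamma> x y = ft \<gamma> x y))"
proof -
  obtain C :: "'a set" where C: "finite C" "span C = UNIV"
    using finite_dim by blast
  have seg: "closed_segment x y \<subseteq> gauge_segment \<gamma> x y" for x y
    by (rule closed_segment_subset_gauge_segment[OF gauge])
  then have ends: "x \<in> gauge_segment \<gamma> x y" "y \<in> gauge_segment \<gamma> x y" for x y
    by auto
  have norm_ft: "gauge_segment \<gamma> x y = ft \<gamma> x y" "closed_segment x y \<subseteq> ft \<gamma> x y"
    if "is_norm \<gamma>" for x y
    using norm_gauge_segment_eq_ft[OF that] seg by auto
  have norm_infinite: "infinite (ft \<gamma> x y)" if "is_norm \<gamma>" "x \<noteq> y" for x y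
    using infinite_super[OF norm_ft(2)[OF that(1)]] that(2) by (metis finite_closed_segment)
  have norm_relint: "relint (closed_segment x y) \<inter> ft \<gamma> x y \<noteq> {}"
    "relint (gauge_segment \<gamma> x y) \<inter> ft \<gamma> x y \<noteq> {}" if "is_norm \<gamma>" for x y
  proof -
    have "relint (closed_segment x y) \<noteq> {}"
      by (rule relint_convex_nonempty[OF C]) auto
    moreover have "relint (closed_segment x y) \<subseteq> ft \<gamma> x y"
      using relint_subset norm_ft(2)[OF that] by (rule order_trans)
    ultimately show "relint (closed_segment x y) \<inter> ft \<gamma> x y \<noteq> {}"
      by (simp add: Int_absorb2)
    have "gauge_segment \<gamma> x y \<noteq> {}"
      using ends(1)[of x y] by auto
    then have "relint (gauge_segment \<gamma> x y) \<noteq> {}"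
      by (rule relint_convex_nonempty[OF C convex_gauge_segment[OF gauge]])
    moreover have "relint (gauge_segment \<gamma> x y) \<subseteq> ft \<gamma> x y"
      using relint_subset[of "gauge_segment \<gamma> x y"] norm_ft(1)[OF that, of x y] by simp
    ultimately show "relint (gauge_segment \<gamma> x y) \<inter> ft \<gamma> x y \<noteq> {}"
      by (simp add: Int_absorb2)
  qed
  have not_singleton: "\<not> M \<subseteq> {p}" if "infinite M \<or> 1 < card M" for M and p :: 'a
  proof
    assume "M \<subseteq> {p}"
    then have "finite M" "card M \<le> 1"
      using finite_subset[of M "{p}"] card_mono[of "{p}" M] by auto
    with that show False by simp
  qed
  have other_minimizer: "\<not> ft \<gamma> x y \<subseteq> {x}" if "R \<inter> ft \<gamma> x y \<noteq> {}" "x \<notin> R" for x y R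
    using that by auto
  have endpoint: "x \<notin> relint (closed_segment x y)" "x \<notin> relint (gauge_segment \<gamma> x y)"
    if "x \<noteq> y" for x y
    using endpoint_notin_relint[OF gauge that seg] endpoint_notin_relint[OF gauge that subset_refl]
      ends(2) by auto
  have via_other: "is_norm \<gamma> \<longleftrightarrow> (\<forall>x y. x \<noteq> y \<longrightarrow> P x y)"
    if "\<And>x y. is_norm \<gamma> \<Longrightarrow> x \<noteq> y \<Longrightarrow> P x y"
      and "\<And>x y. x \<noteq> y \<Longrightarrow> P x y \<Longrightarrow> \<not> ft \<gamma> x y \<subseteq> {x}" for P
    using that exists_ft_singleton[OF C gauge] by metis
  have via_endpoint: "is_norm \<gamma> \<longleftrightarrow> (\<forall>x y. x \<noteq> y \<longrightarrow> P x y)"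
    if "\<And>x y. is_norm \<gamma> \<Longrightarrow> x \<noteq> y \<Longrightarrow> P x y"
      and "\<And>x y. x \<noteq> y \<Longrightarrow> P x y \<Longrightarrow> x \<in> ft \<gamma> x y" for P
    using that is_norm_if_endpoint_in_ft[OF gauge] by metis
  show ?thesis
  proof (intro conjI)
    show "is_norm \<gamma> \<longleftrightarrow> (\<forall>x y. x \<noteq> y \<longrightarrow> infinite (ft \<gamma> x y) \<or> card (ft \<gamma> x y) > 1)"
      by (rule via_other) (simp_all add: norm_infinite not_singleton)
    show "is_norm \<gamma> \<longleftrightarrow> (\<forall>x y. x \<noteq> y \<longrightarrow> infinite (ft \<gamma> x y))"
      by (rule via_other) (simp_all add: norm_infinite not_singleton)
    have norm_other: "ft \<gamma> x y - {x, y} \<noteq> {}" if "is_norm \<gamma>" "x \<noteq> y" for x y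
      using Diff_infinite_finite[OF _ norm_infinite[OF that], of "{x, y}"] by force
    then show "is_norm \<gamma> \<longleftrightarrow> (\<forall>x y. x \<noteq> y \<longrightarrow> ft \<gamma> x y - {x, y} \<noteq> {})"
      by (rule via_other) auto
    show "is_norm \<gamma> \<longleftrightarrow> (\<forall>x y. x \<noteq> y \<longrightarrow> ft \<gamma> x y - {x} \<noteq> {})"
      by (rule via_other) (use norm_other in auto)
    show "is_norm \<gamma> \<longleftrightarrow> (\<forall>x y. x \<noteq> y \<longrightarrow> x \<in> ft \<gamma> x y)"
      by (rule via_endpoint) (use norm_ft(2) in auto)
    show "is_norm \<gamma> \<longleftrightarrow> (\<forall>x y. x \<noteq> y \<longrightarrow> {x, y} \<subseteq> ft \<gamma> x y)"
      by (rule via_endpoint) (use norm_ft(2) in auto)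
    show "is_norm \<gamma> \<longleftrightarrow> (\<forall>x y. x \<noteq> y \<longrightarrow> closed_segment x y \<subseteq> ft \<gamma> x y)"
      by (rule via_endpoint) (use norm_ft(2) in auto)
    show "is_norm \<gamma> \<longleftrightarrow> (\<forall>x y. x \<noteq> y \<longrightarrow> relint (closed_segment x y) \<inter> ft \<gamma> x y \<noteq> {})"
      by (rule via_other) (use norm_relint(1) other_minimizer endpoint(1) in \<open>simp, metis\<close>)
    show "is_norm \<gamma> \<longleftrightarrow> (\<forall>x y. x \<noteq> y \<longrightarrow> gauge_segment \<gamma> x y \<subseteq> ft \<gamma> x y)"
      by (rule via_endpoint) (use norm_ft(1) ends(1) in auto)
    show "is_norm \<gamma> \<longleftrightarrow> (\<forall>x y. x \<noteq> y \<longrightarrow> relint (gauge_segment \<gamma> x y) \<inter> ft \<gamma> x y \<noteq> {})"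
      by (rule via_other) (use norm_relint(2) other_minimizer endpoint(2) in \<open>simp, metis\<close>)
    show "is_norm \<gamma> \<longleftrightarrow> (\<forall>x y. x \<noteq> y \<longrightarrow> gauge_segment \<gamma> x y = ft \<gamma> x y)"
      by (rule via_endpoint) (use norm_ft(1) ends(1) in auto)
  qed
qed

end
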